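(* Let $2\leq p<\infty$, $\alpha>0$, $\kappa>0$, and let $m$ be a positive integer with $m\geq(p-1)2^{p+1}$. Set $$\epsilon_p(\alpha)=\frac{\alpha}{2(p+1)^{1/p}}\big(m+\kappa(p+1)\sqrt{m}\big)^{1/p},\qquad \mu_{p,2}=\mathbb{E}\|\xi\|_p,$$ where $\xi\in\mathbb{R}^m$ is a random vector with i.i.d. $\mathcal{N}(0,1)$ entries. Then $$\frac{\epsilon_p(\alpha)}{\mu_{p,2}}\ \leq\ \frac{p}{p-1}\,\frac{9e}{16\sqrt2}\,\Big(\frac{1}{p+1}+\frac{\kappa}{\sqrt m}\Big)^{1/p}\,\frac{\alpha}{\sqrt{p+1}},$$ and if moreover $m>\big(\tfrac{p+1}{p}\kappa\big)^2$, then $$\frac{\epsilon_p(\alpha)}{\mu_{p,2}}\ <\ C\,\frac{\alpha}{\sqrt{p+1}},\qquad C=\frac{9e}{8\sqrt2}<2.17 .$$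
   Context: $\|u\|_p=(\sum_i|u_i|^p)^{1/p}$. Here $\alpha$ is the bin width of a uniform quantizer, $\epsilon_p(\alpha)$ is the $\ell_p$-radius used in the data-fidelity constraint for quantized measurements, and $\mu_{p,2}$ is the scaling constant associated with Gaussian sensing matrices with $m$ rows. *)

theory Defs
  imports "HOL-Probability.Probability"
begin

text \<open>Vectors of \<open>\<real>\<^sup>m\<close> are functions on \<open>nat\<close>, of which only the coordinates \<open>i < m\<close> are used.\<close>

definition lp_norm :: "nat \<Rightarrow> real \<Rightarrow> (nat \<Rightarrow> real) \<Rightarrow> real" where
  "lp_norm m p u = (\<Sum>i<m. \<bar>u i\<bar> powr p) powr (1 / p)"

definition std_gaussian_vector :: "'a measure \<Rightarrow> nat \<Rightarrow> (nat \<Rightarrow> 'a \<Rightarrow> real) \<Rightarrow> bool" where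
  "std_gaussian_vector M m \<xi> \<longleftrightarrow>
     prob_space M \<and>
     prob_space.indep_vars M (\<lambda>_. borel) \<xi> {..<m} \<and>
     (\<forall>i<m. distributed M lborel (\<xi> i) (\<lambda>x. ennreal (std_normal_density x)))"

definition \<mu>\<^sub>2 :: "'a measure \<Rightarrow> nat \<Rightarrow> real \<Rightarrow> (nat \<Rightarrow> 'a \<Rightarrow> real) \<Rightarrow> real" where
  "\<mu>\<^sub>2 M m p \<xi> = prob_space.expectation M (\<lambda>\<omega>. lp_norm m p (\<lambda>i. \<xi> i \<omega>))"

definition \<epsilon> :: "nat \<Rightarrow> real \<Rightarrow> real \<Rightarrow> real \<Rightarrow> real" where
  "\<epsilon> m \<kappa> p \<alpha> =
     \<alpha> / (2 * (p + 1) powr (1 / p)) * (real m + \<kappa> * (p + 1) * sqrt (real m)) powr (1 / p)"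

end

theory Submission
  imports Defs
begin

text \<open>
  The quotient is bounded by bounding \<open>\<mu>\<^sub>2 = E \<parallel>\<xi>\<parallel>\<^sub>p\<close> from below. Let \<open>S = \<Sum>i<m. \<bar>\<xi> i\<bar>\<^sup>p\<close> and
  let \<open>\<nu> p\<close> be the absolute moment of order \<open>p\<close> of a standard normal variable, so that
  \<open>E S = m \<nu> p\<close> and \<open>\<mu>\<^sub>2 = E S\<^sup>1\<^sup>/\<^sup>p\<close>. Jensen's inequality bounds \<open>E S\<^sup>1\<^sup>/\<^sup>p\<close> from above only; a
  reverse inequality needs \<open>S\<close> to be concentrated. It comes from a parabola lying below
  \<open>t \<mapsto> t\<^sup>1\<^sup>/\<^sup>p\<close> (\<open>powr_inverse_ge_parabola\<close>): if \<open>E S\<^sup>2 \<le> p / (p - 1) (E S)\<^sup>2\<close>, then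
  \<open>E S\<^sup>1\<^sup>/\<^sup>p \<ge> (p - 1) / p (E S)\<^sup>1\<^sup>/\<^sup>p\<close> (\<open>expectation_powr_inverse_ge\<close>).

  By independence, \<open>E S\<^sup>2 = (E S)\<^sup>2 + m (\<nu> (2 p) - (\<nu> p)\<^sup>2)\<close>, and the estimate
  \<open>\<nu> (2 p) \<le> 2\<^sup>p\<^sup>+\<^sup>1 (\<nu> p)\<^sup>2\<close> (\<open>normal_abs_moment_double_le\<close>) is exactly what turns
  \<open>m \<ge> (p - 1) 2\<^sup>p\<^sup>+\<^sup>1\<close> into the concentration that is required. The size of the moment is
  \<open>\<nu> p \<ge> (\<surd>(p + 1) / 2)\<^sup>p\<close> (\<open>normal_abs_moment_ge\<close>). Both estimates become statements about the
  Gamma function through \<open>\<nu> p = 2\<^sup>p\<^sup>/\<^sup>2 \<Gamma>((p + 1) / 2) / \<surd>\<pi>\<close>, and both follow from its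
  log-convexity, together with the duplication formula for the first and the functional equation
  for the second.

  Together these give \<open>\<mu>\<^sub>2 \<ge> (p - 1) / p m\<^sup>1\<^sup>/\<^sup>p \<surd>(p + 1) / 2\<close>, hence the first claim, as
  \<open>9 e / (16 \<surd>2) \<approx> 1.08\<close> is at least \<open>1\<close>. For \<open>m > ((p + 1) \<kappa> / p)\<^sup>2\<close> the base \<open>1 / (p + 1) + \<kappa> / \<surd>m\<close>
  is less than \<open>1\<close>, and \<open>p / (p - 1) \<le> 2\<close>, which gives the strict bound.
\<close>

section \<open>Bounds for the Gamma function\<close>

lemma Gamma_real_plus1: "0 < b \<Longrightarrow> Gamma (b + 1) = b * Gamma b" for b :: real
  by (intro Gamma_plus1) (auto elim: nonpos_Ints_cases)

lemma Gamma_real_nonzero: "0 < b \<Longrightarrow> Gamma b \<noteq> 0" for b :: real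
  using Gamma_real_pos[of b] by linarith

text \<open>A convex function lies above its chords outside the interval that they span; the chord of
  \<open>ln \<circ> \<Gamma>\<close> over \<open>[b - 1, b]\<close> has slope \<open>ln (b - 1)\<close> by the functional equation.\<close>

lemma Gamma_extrapolate:
  fixes b t :: real
  assumes "1 < b" "0 \<le> t"
  shows "Gamma b * (b - 1) powr t \<le> Gamma (b + t)"
proof -
  \<comment> \<open>The weight with which \<open>b\<close> divides the segment from \<open>b - 1\<close> to \<open>b + t\<close>.\<close>
  define l where "l = 1 / (1 + t)"
  have l: "0 \<le> l" "l \<le> 1" "l * (1 + t) = 1" using assms by (auto simp: l_def field_simps)
  have step: "ln (Gamma (b - 1)) = ln (Gamma b) - ln (b - 1)"
    using Gamma_real_plus1[of "b - 1"] Gamma_real_nonzero[of "b - 1"] assms by (simp add: ln_mult)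
  have "(1 - l) *\<^sub>R (b - 1) + l *\<^sub>R (b + t) = b"
    using l(3) by (simp add: algebra_simps)
  with convex_onD[OF log_convex_Gamma_real l(1,2), of "b - 1" "b + t"] assms
  have "ln (Gamma b) \<le> (1 - l) * ln (Gamma (b - 1)) + l * ln (Gamma (b + t))" by simp
  then have "(1 + t) * ln (Gamma b) \<le> (1 + t) * ((1 - l) * ln (Gamma (b - 1)) + l * ln (Gamma (b + t)))"
    using assms by (intro mult_left_mono) auto
  also have "\<dots> = ((1 + t) - l * (1 + t)) * ln (Gamma (b - 1)) + (l * (1 + t)) * ln (Gamma (b + t))"
    by (simp add: algebra_simps)
  also have "\<dots> = t * (ln (Gamma b) - ln (b - 1)) + ln (Gamma (b + t))"
    unfolding l(3) step by simp
  finally have "ln (Gamma b) + t * ln (b - 1) \<le> ln (Gamma (b + t))"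
    by (simp add: algebra_simps)
  then have "exp (ln (Gamma b) + t * ln (b - 1)) \<le> exp (ln (Gamma (b + t)))" by simp
  then show ?thesis using assms by (simp add: exp_add powr_def)
qed

text \<open>The companion of the previous bound: between its ends, the chord of \<open>ln \<circ> \<Gamma>\<close> over
  \<open>[b, b + 1]\<close>, of slope \<open>ln b\<close>, lies above the graph.\<close>

lemma Gamma_interpolate:
  fixes b t :: real
  assumes "0 < b" "0 \<le> t" "t \<le> 1"
  shows "Gamma (b + t) \<le> Gamma b * b powr t"
proof -
  have "(1 - t) *\<^sub>R b + t *\<^sub>R (b + 1) = b + t" by (simp add: algebra_simps)
  with convex_onD[OF log_convex_Gamma_real assms(2,3), of b "b + 1"] assms
  have "ln (Gamma (b + t)) \<le> (1 - t) * ln (Gamma b) + t * ln (Gamma (b + 1))" by simp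
  also have "Gamma (b + 1) = b * Gamma b" using assms by (intro Gamma_real_plus1) auto
  also have "(1 - t) * ln (Gamma b) + t * ln (b * Gamma b) = ln (Gamma b) + t * ln b"
    using assms Gamma_real_nonzero[of b] by (simp add: ln_mult algebra_simps)
  finally have "exp (ln (Gamma (b + t))) \<le> exp (ln (Gamma b) + t * ln b)" by simp
  then show ?thesis using assms by (simp add: exp_add powr_def)
qed

text \<open>A weak form of Stirling's bound, in which \<open>e\<close> is replaced by \<open>4\<close>. The slack makes an induction
  by unit steps possible: a step multiplies \<open>\<Gamma>\<close> by \<open>b\<close> and the left-hand side by
  \<open>b / 4 (1 + 1 / b)\<^sup>b\<^sup>+\<^sup>1\<^sup>/\<^sup>2\<close>, and the power is at most \<open>exp (4 / 3) \<le> 4\<close> for \<open>b \<ge> 3 / 2\<close>.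
  On the initial interval \<open>[3 / 2, 5 / 2]\<close>, extrapolation from \<open>3 / 2\<close> suffices up to \<open>2\<close>, where
  \<open>a / 4 \<le> 1 / 2\<close>, and \<open>\<Gamma> a \<ge> 1\<close> suffices beyond.\<close>

lemma Gamma_ge:
  fixes a :: real
  assumes "3 / 2 \<le> a"
  shows "sqrt pi * (a / 4) powr (a - 1 / 2) \<le> Gamma a"
proof -
  have "3 / 2 \<le> a \<Longrightarrow> a \<le> 5 / 2 + real n \<Longrightarrow> ?thesis" for n
  proof (induction n arbitrary: a)
    case 0
    show ?case
    proof (cases "a \<le> 2")
      case True
      have G32: "Gamma (3 / 2 :: real) = sqrt pi / 2"
        using Gamma_real_plus1[of "1 / 2"] by (simp add: Gamma_one_half_real)
      have "(a / 4) powr (a - 1 / 2) \<le> (1 / 2) powr (a - 1 / 2)"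
        using 0 True by (intro powr_mono2) auto
      also have "\<dots> = 1 / 2 * (1 / 2) powr (a - 3 / 2)"
        using powr_mult_base[of "1/2" "a - 3/2"] by (simp add: algebra_simps)
      finally have "sqrt pi * (a / 4) powr (a - 1 / 2) \<le> sqrt pi * (1 / 2 * (1 / 2) powr (a - 3 / 2))"
        by (intro mult_left_mono) auto
      also have "\<dots> \<le> Gamma a"
        using Gamma_extrapolate[of "3 / 2" "a - 3 / 2"] 0 by (simp add: G32)
      finally show ?thesis .
    next
      case False
      \<comment> \<open>Here \<open>a / 4 \<le> 5 / 8\<close>; the larger \<open>16 / 25\<close> is a square of a rational.\<close>
      have "(a / 4) powr (a - 1 / 2) \<le> (a / 4) powr (3 / 2)"
        using 0 False by (intro powr_mono') auto
      also have "\<dots> \<le> (16 / 25) powr (3 / 2)"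
        using 0 False by (intro powr_mono2) auto
      also have "\<dots> = 64 / 125"
        using powr_mult_base[of "16/25::real" "1/2"] by (simp add: powr_half_sqrt real_sqrt_divide)
      finally have "sqrt pi * (a / 4) powr (a - 1 / 2) \<le> sqrt pi * (64 / 125)"
        by (intro mult_left_mono) auto
      also have "sqrt pi \<le> sqrt (1.8\<^sup>2)"
        using pi_less_4 pi_approx by (intro real_sqrt_le_mono) (simp add: power2_eq_square)
      then have "sqrt pi * (64 / 125) \<le> 1" by simp
      also have "1 \<le> Gamma a"
        using Gamma_extrapolate[of 2 "a - 2"] False Gamma_fact[of 1, where 'a = real] by simp
      finally show ?thesis .
    qed
  next
    case (Suc n)
    show ?case
    proof (cases "a \<le> 5 / 2 + real n")
      case True
      then show ?thesis using Suc by simp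
    next
      case False
      define b where "b = a - 1"
      have b: "3 / 2 \<le> b" "b \<le> 5 / 2 + real n" "a = b + 1" using False Suc.prems by (auto simp: b_def)
      have "(b + 1/2) * ln (1 + 1 / b) \<le> (b + 1/2) * (1 / b)"
        using b by (intro mult_left_mono ln_add_one_self_le_self) auto
      also have "\<dots> \<le> 4 / 3" using b by (simp add: field_simps)
      also have "4 / 3 \<le> 2 * ln (2::real)" using ln2_ge_two_thirds by simp
      also have "\<dots> = ln 4" using ln_realpow[of 2 2] by simp
      finally have "exp ((b + 1/2) * ln (1 + 1 / b)) \<le> exp (ln 4)" by (simp only: exp_le_cancel_iff)
      then have grow: "(1 + 1 / b) powr (b + 1/2) \<le> 4"
        using b by (simp add: powr_def add_pos_pos)
      have "(a / 4) powr (a - 1/2) = (b / 4 * (1 + 1 / b)) powr (b + 1/2)"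
      proof -
        have "a / 4 = b / 4 * (1 + 1 / b)" "a - 1/2 = b + 1/2" using b by (simp_all add: field_simps)
        then show ?thesis by (simp only:)
      qed
      also have "\<dots> = b / 4 * (b / 4) powr (b - 1/2) * (1 + 1 / b) powr (b + 1/2)"
        using b powr_mult_base[of "b / 4" "b - 1 / 2"] by (simp only: powr_mult) (simp add: add.commute)
      also have "\<dots> \<le> b / 4 * (b / 4) powr (b - 1/2) * 4"
        using b grow by (intro mult_left_mono) auto
      finally have "sqrt pi * (a / 4) powr (a - 1/2) \<le> b * (sqrt pi * (b / 4) powr (b - 1/2))"
        by (simp add: mult_left_mono)
      also have "\<dots> \<le> b * Gamma b"
        using b Suc.IH[of b] by (intro mult_left_mono) auto
      also have "\<dots> = Gamma a"
        unfolding b(3) using b by (intro Gamma_real_plus1[symmetric]) auto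
      finally show ?thesis .
    qed
  qed
  moreover obtain n :: nat where "a - 5/2 \<le> real n" using real_arch_simple by blast
  ultimately show ?thesis using assms by (simp add: algebra_simps)
qed

text \<open>Duplication at \<open>z = a - 1 / 4\<close>, where \<open>a = (p + 1) / 2\<close>, writes \<open>\<Gamma>(p + 1 / 2)\<close> in terms of
  \<open>\<Gamma>(a - 1 / 4) \<Gamma>(a + 1 / 4)\<close>, which log-convexity compares with \<open>(\<Gamma> a)\<^sup>2\<close>: the quotient is at
  most \<open>(a / (a - 5 / 4))\<^sup>1\<^sup>/\<^sup>4 \<le> 6\<^sup>1\<^sup>/\<^sup>4 < 2\<close>.\<close>

lemma Gamma_half_duplication_bound:
  fixes p :: real
  assumes "2 \<le> p"
  shows "sqrt pi * Gamma (p + 1 / 2) \<le> 2 powr (p + 1) * (Gamma ((p + 1) / 2))\<^sup>2"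
proof -
  define a where "a = (p + 1) / 2"
  define z where "z = a - 1 / 4"
  have a: "3 / 2 \<le> a" using assms by (simp add: a_def)
  have z: "0 < z" using a by (simp add: z_def)
  have nonpos: "complex_of_real x \<notin> \<int>\<^sub>\<le>\<^sub>0" if "0 < x" for x
    using that by (auto simp: of_real_in_nonpos_Ints_iff)
  have "complex_of_real z + 1/2 = of_real (z + 1/2)" by simp
  moreover have "2 * complex_of_real z = of_real (2 * z)" by simp
  moreover have "exp ((1 - of_real (2 * z)) * of_real (ln 2)) = complex_of_real (exp ((1 - 2 * z) * ln 2))"
    by (simp flip: exp_of_real)
  ultimately have "complex_of_real (Gamma z * Gamma (z + 1/2)) =
        complex_of_real (exp ((1 - 2 * z) * ln 2) * sqrt pi * Gamma (2 * z))"
    using Gamma_legendre_duplication[of "complex_of_real z"] nonpos[of z] nonpos[of "z + 1/2"] z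
    by (simp only: Gamma_complex_of_real of_real_mult)
      (metis Gamma_complex_of_real of_real_mult)
  then have "Gamma z * Gamma (z + 1/2) = exp ((1 - 2 * z) * ln 2) * sqrt pi * Gamma (2 * z)"
    by (simp only: of_real_eq_iff)
  moreover have "exp ((1 - 2 * z) * ln 2) = 1 / 2 powr (p - 1/2)"
    by (simp add: powr_def z_def a_def field_simps flip: exp_add)
  moreover have "2 * z = p + 1/2" "z = a - 1/4" "z + 1/2 = a + 1/4" by (simp_all add: z_def a_def)
  ultimately have dup: "sqrt pi * Gamma (p + 1/2) = 2 powr (p - 1/2) * (Gamma (a - 1/4) * Gamma (a + 1/4))"
    by (simp add: add.commute)
  have "Gamma (a - 1/4) * (a - 5/4) powr (1/4) \<le> Gamma a"
    using Gamma_extrapolate[of "a - 1/4" "1/4"] a by simp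
  then have 1: "Gamma (a - 1/4) \<le> Gamma a / (a - 5/4) powr (1/4)"
    using a by (simp add: field_simps)
  have 2: "Gamma (a + 1/4) \<le> Gamma a * a powr (1/4)"
    using Gamma_interpolate[of a "1/4"] a by simp
  have "Gamma (a - 1/4) * Gamma (a + 1/4) \<le> Gamma a / (a - 5/4) powr (1/4) * (Gamma a * a powr (1/4))"
    using a by (intro mult_mono 1 2) auto
  also have "\<dots> = (Gamma a)\<^sup>2 * (a / (a - 5/4)) powr (1/4)"
    using a by (simp add: powr_divide power2_eq_square)
  also have "(a / (a - 5/4)) powr (1/4) \<le> (2 powr 4) powr (1/4)"
    using a by (intro powr_mono2) (auto simp: field_simps)
  also have "\<dots> = 2" by (simp only: powr_powr) simp
  finally have "sqrt pi * Gamma (p + 1/2) \<le> 2 powr (p - 1/2) * ((Gamma a)\<^sup>2 * 2)"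
    unfolding dup by (simp add: mult_left_mono)
  also have "\<dots> = 2 powr (p + 1/2) * (Gamma a)\<^sup>2"
    using powr_mult_base[of 2 "p - 1/2"] by (simp add: algebra_simps)
  also have "\<dots> \<le> 2 powr (p + 1) * (Gamma a)\<^sup>2"
    by (intro mult_right_mono powr_mono) auto
  finally show ?thesis by (simp add: a_def)
qed

section \<open>Absolute moments of the standard normal distribution\<close>

text \<open>The substitution \<open>t = x\<^sup>2 / 2\<close> turns Euler's integral for \<open>\<Gamma>((p + 1) / 2)\<close> into the
  moment over the positive half-line; evenness of the integrand doubles it.\<close>

lemma std_normal_abs_moment:
  fixes p :: real
  assumes "-1 < p"
  shows "has_bochner_integral lborel (\<lambda>x. std_normal_density x * \<bar>x\<bar> powr p)
           (2 powr (p / 2) * Gamma ((p + 1) / 2) / sqrt pi)"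
proof -
  define a where "a = (p + 1) / 2"
  have a: "0 < a" using assms by (simp add: a_def)
  define c where "c = 2 powr (p / 2) / (2 * sqrt pi)"
  let ?f = "\<lambda>t::real. t powr (a - 1) / exp t"
  let ?h = "\<lambda>x::real. std_normal_density x * \<bar>x\<bar> powr p"
  have half_line: "(f has_integral y) {0<..} \<longleftrightarrow> (f has_integral y) {0..}" for f :: "real \<Rightarrow> real" and y
    using has_integral_interior[of "{0..}" f y] by (simp add: interior_real_atLeast frontier_real_atLeast)
  have hi: "(?f has_integral Gamma a) {0<..}"
    unfolding half_line by (rule Gamma_integral_real[OF a])
  \<comment> \<open>The change of variables runs over the open half-line, where \<open>x \<mapsto> x\<^sup>2 / 2\<close> is injective.\<close>
  have img: "(\<lambda>x::real. x\<^sup>2 / 2) ` {0<..} = {0<..}"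
  proof (intro equalityI subsetI)
    fix y :: real assume "y \<in> {0<..}"
    then show "y \<in> (\<lambda>x. x\<^sup>2 / 2) ` {0<..}"
      by (intro image_eqI[of _ _ "sqrt (2 * y)"]) auto
  qed auto
  have "?f absolutely_integrable_on {0<..}"
    using hi by (intro nonnegative_absolutely_integrable_1) (auto simp: has_integral_integrable)
  then have sub: "(\<lambda>x. \<bar>x\<bar> * ?f (x\<^sup>2 / 2)) absolutely_integrable_on {0<..} \<and>
      integral {0<..} (\<lambda>x. \<bar>x\<bar> * ?f (x\<^sup>2 / 2)) = Gamma a"
    using hi
    by (subst has_absolute_integral_change_of_variables_1'[where g = "\<lambda>x. x\<^sup>2 / 2" and g' = "\<lambda>x. x"])
       (auto simp: img inj_on_def has_integral_iff power2_eq_iff intro!: derivative_eq_intros)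
  have eq: "c * (\<bar>x\<bar> * ?f (x\<^sup>2 / 2)) = ?h x" if "x \<in> {0<..}" for x
  proof -
    from that have x: "0 < x" by simp
    have 1: "(x\<^sup>2 / 2) powr (a - 1) = x powr (p - 1) / 2 powr ((p - 1) / 2)"
      using x by (simp add: powr_divide powr_powr a_def diff_divide_distrib flip: powr_numeral)
    define X where "X = x powr (p - 1)"
    have 2: "x powr p = x * X"
      using x by (simp add: X_def powr_mult_base)
    have 3: "(2::real) powr (p / 2) = 2 powr ((p - 1) / 2) * sqrt 2"
      by (simp add: powr_half_sqrt[symmetric] diff_divide_distrib flip: powr_add)
    show ?thesis
      unfolding 1 c_def 3 std_normal_density_def X_def[symmetric] using x 2
      by (simp add: field_simps real_sqrt_mult exp_minus)
  qed
  have "(?h has_integral c * Gamma a) {0<..}"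
  proof (rule has_integral_eq[OF eq])
    show "((\<lambda>x. c * (\<bar>x\<bar> * ?f (x\<^sup>2 / 2))) has_integral c * Gamma a) {0<..}"
      using sub by (intro has_integral_mult_right) (auto simp: has_integral_iff absolutely_integrable_on_def)
  qed
  then have "(?h has_integral c * Gamma a) {0..}"
    unfolding half_line .
  then have "((\<lambda>x. indicator {0..} x *\<^sub>R ?h x) has_integral c * Gamma a) UNIV"
    by (subst (asm) has_integral_restrict_UNIV[symmetric])
       (auto elim!: back_subst[of "\<lambda>f. (f has_integral _) _"] simp: indicator_def)
  then have "has_bochner_integral lborel (\<lambda>x. indicator {0..} x *\<^sub>R ?h x) (c * Gamma a)"
    using a by (intro has_bochner_integral_nn_integral nn_integral_has_integral_lborel)
       (auto simp: c_def intro!: mult_nonneg_nonneg divide_nonneg_nonneg)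
  then have "has_bochner_integral lborel ?h (2 *\<^sub>R (c * Gamma a))"
    by (rule has_bochner_integral_even_function) (simp add: std_normal_density_def)
  then show ?thesis
    by (simp add: c_def a_def field_simps)
qed

text \<open>The moment of order \<open>p\<close> in closed form, to which the Gamma bounds apply directly.\<close>

definition normal_abs_moment :: "real \<Rightarrow> real" where
  "normal_abs_moment p = 2 powr (p / 2) * Gamma ((p + 1) / 2) / sqrt pi"

lemma normal_abs_moment_ge:
  assumes "2 \<le> p"
  shows "(sqrt (p + 1) / 2) powr p \<le> normal_abs_moment p"
proof -
  have "(sqrt (p + 1) / 2) powr p = (((p + 1) / 4) powr (1 / 2)) powr p"
    using assms by (simp add: powr_half_sqrt real_sqrt_divide)
  also have "(p + 1) / 4 = 2 * ((p + 1) / 2 / 4)" by simp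
  also have "(\<dots> powr (1 / 2)) powr p = \<dots> powr (p / 2)" by (simp only: powr_powr) simp
  also have "\<dots> = 2 powr (p / 2) * ((p + 1) / 2 / 4) powr ((p + 1) / 2 - 1 / 2)"
    by (simp only: powr_mult) (simp add: add_divide_distrib)
  also have "\<dots> \<le> 2 powr (p / 2) * (Gamma ((p + 1) / 2) / sqrt pi)"
    using Gamma_ge[of "(p + 1) / 2"] assms by (intro mult_left_mono) (simp_all add: field_simps)
  finally show ?thesis by (simp add: normal_abs_moment_def)
qed

text \<open>Equivalently, \<open>\<bar>g\<bar>\<^sup>p\<close> for a standard normal \<open>g\<close> has relative second moment at most
  \<open>2\<^sup>p\<^sup>+\<^sup>1\<close>, so that averaging at least \<open>(p - 1) 2\<^sup>p\<^sup>+\<^sup>1\<close> independent copies brings the relative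
  variance down to at most \<open>1 / (p - 1)\<close>.\<close>

lemma normal_abs_moment_double_le:
  assumes "2 \<le> p"
  shows "normal_abs_moment (2 * p) \<le> 2 powr (p + 1) * (normal_abs_moment p)\<^sup>2"
proof -
  have sq: "(normal_abs_moment p)\<^sup>2 = 2 powr p * (Gamma ((p + 1) / 2))\<^sup>2 / pi"
    by (simp add: normal_abs_moment_def power_divide power_mult_distrib power2_eq_square flip: powr_add)
  have arg: "(2 * p + 1) / 2 = p + 1 / 2" by simp
  have "normal_abs_moment (2 * p) = 2 powr p * (sqrt pi * Gamma (p + 1 / 2)) / pi"
    unfolding normal_abs_moment_def arg by (simp add: field_simps)
  also have "\<dots> \<le> 2 powr p * (2 powr (p + 1) * (Gamma ((p + 1) / 2))\<^sup>2) / pi"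
    using Gamma_half_duplication_bound[OF assms] by (intro divide_right_mono mult_left_mono) auto
  finally show ?thesis by (simp add: sq mult_ac)
qed

lemma std_gaussian_abs_moment:
  assumes "distributed M lborel X (\<lambda>x. ennreal (std_normal_density x))" and "-1 < p"
  shows "integrable M (\<lambda>\<omega>. \<bar>X \<omega>\<bar> powr p)" and "(\<integral>\<omega>. \<bar>X \<omega>\<bar> powr p \<partial>M) = normal_abs_moment p"
proof -
  note mom = std_normal_abs_moment[OF assms(2), folded normal_abs_moment_def, unfolded has_bochner_integral_iff]
  show "integrable M (\<lambda>\<omega>. \<bar>X \<omega>\<bar> powr p)"
    using mom distributed_integrable[OF assms(1), of "\<lambda>x. \<bar>x\<bar> powr p"] by simp
  show "(\<integral>\<omega>. \<bar>X \<omega>\<bar> powr p \<partial>M) = normal_abs_moment p"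
    using mom distributed_integral[OF assms(1), of "\<lambda>x. \<bar>x\<bar> powr p"] by simp
qed

section \<open>Concentration and the mean of a root\<close>

lemma (in prob_space) indep_sum_moments:
  fixes Y :: "nat \<Rightarrow> 'a \<Rightarrow> real"
  assumes "indep_vars (\<lambda>_. borel) Y {..<n}"
    and "\<And>i. i < n \<Longrightarrow> integrable M (Y i)" and "\<And>i. i < n \<Longrightarrow> integrable M (\<lambda>\<omega>. (Y i \<omega>)\<^sup>2)"
    and "\<And>i. i < n \<Longrightarrow> expectation (Y i) = a" and "\<And>i. i < n \<Longrightarrow> expectation (\<lambda>\<omega>. (Y i \<omega>)\<^sup>2) = b"
  shows "integrable M (\<lambda>\<omega>. \<Sum>i<n. Y i \<omega>) \<and> expectation (\<lambda>\<omega>. \<Sum>i<n. Y i \<omega>) = n * a \<and>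
    integrable M (\<lambda>\<omega>. (\<Sum>i<n. Y i \<omega>)\<^sup>2) \<and>
    expectation (\<lambda>\<omega>. (\<Sum>i<n. Y i \<omega>)\<^sup>2) = n * (b - a\<^sup>2) + (n * a)\<^sup>2"
  using assms
proof (induction n)
  case (Suc n)
  define S where "S \<omega> = (\<Sum>i<n. Y i \<omega>)" for \<omega>
  have "integrable M S \<and> expectation S = n * a \<and>
      integrable M (\<lambda>\<omega>. (S \<omega>)\<^sup>2) \<and> expectation (\<lambda>\<omega>. (S \<omega>)\<^sup>2) = n * (b - a\<^sup>2) + (n * a)\<^sup>2"
    using Suc.IH indep_vars_subset[OF Suc.prems(1), of "{..<n}"] Suc.prems(2-)
    by (simp add: S_def[abs_def] lessThan_Suc subset_insertI)
  then have S: "integrable M S" "expectation S = n * a"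
    "integrable M (\<lambda>\<omega>. (S \<omega>)\<^sup>2)" "expectation (\<lambda>\<omega>. (S \<omega>)\<^sup>2) = n * (b - a\<^sup>2) + (n * a)\<^sup>2" by auto
  have Y: "integrable M (Y n)" "expectation (Y n) = a"
    "integrable M (\<lambda>\<omega>. (Y n \<omega>)\<^sup>2)" "expectation (\<lambda>\<omega>. (Y n \<omega>)\<^sup>2) = b" using Suc.prems by auto
  have "indep_var borel (Y n) borel S"
    unfolding S_def[abs_def] using Suc.prems(1) by (intro indep_vars_sum) (auto simp: lessThan_Suc)
  note cross = indep_var_integrable[OF this Y(1) S(1)] indep_var_lebesgue_integral[OF this Y(1) S(1)]
  have sq: "(S \<omega> + Y n \<omega>)\<^sup>2 = (S \<omega>)\<^sup>2 + 2 * (Y n \<omega> * S \<omega>) + (Y n \<omega>)\<^sup>2" for \<omega>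
    by (simp add: power2_sum)
  show ?case
    unfolding sum.lessThan_Suc S_def[symmetric] sq
    using S Y cross by simp (simp add: algebra_simps power2_eq_square)
qed simp

text \<open>Weighted arithmetic-geometric mean inequality for
  \<open>t = (t\<^sup>1\<^sup>/\<^sup>p)\<^sup>\<theta> (t\<^sup>2)\<^sup>1\<^sup>-\<^sup>\<theta>\<close> with \<open>\<theta> = p / (2 p - 1)\<close>. The parabola meets \<open>t\<^sup>1\<^sup>/\<^sup>p\<close> at
  \<open>t = 0\<close> and is tangent to it at \<open>t = 1\<close>.\<close>

lemma powr_inverse_ge_parabola:
  fixes p t :: real
  assumes "1 \<le> p" "0 \<le> t"
  shows "(2 * p - 1) * t \<le> p * t powr (1 / p) + (p - 1) * t\<^sup>2"
proof (cases "t = 0")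
  case False
  define \<theta> where "\<theta> = p / (2 * p - 1)"
  have \<theta>: "0 \<le> \<theta>" "0 \<le> 1 - \<theta>" using assms by (auto simp: \<theta>_def field_simps)
  have "(t powr (1 / p)) powr \<theta> * (t\<^sup>2) powr (1 - \<theta>) = t powr (1 / p * \<theta> + 2 * (1 - \<theta>))"
    using assms False by (simp add: powr_powr powr_add flip: powr_numeral)
  also have "1 / p * \<theta> + 2 * (1 - \<theta>) = 1"
    using assms by (simp add: \<theta>_def field_simps)
  finally have "t \<le> \<theta> * t powr (1 / p) + (1 - \<theta>) * t\<^sup>2"
    using Youngs_inequality_0[OF \<theta>, of "t powr (1 / p)" "t\<^sup>2"] assms False by simp
  then have "(2 * p - 1) * t \<le> (2 * p - 1) * (\<theta> * t powr (1 / p) + (1 - \<theta>) * t\<^sup>2)"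
    using assms by (intro mult_left_mono) auto
  also have "\<dots> = ((2 * p - 1) * \<theta>) * t powr (1 / p) + ((2 * p - 1) - (2 * p - 1) * \<theta>) * t\<^sup>2"
    by (simp add: algebra_simps)
  also have "(2 * p - 1) * \<theta> = p" using assms by (simp add: \<theta>_def)
  finally show ?thesis by simp
qed simp

lemma (in prob_space) integrable_powr_le_one:
  fixes X :: "'a \<Rightarrow> real"
  assumes X: "integrable M X" "\<And>\<omega>. 0 \<le> X \<omega>" and r: "0 \<le> r" "r \<le> 1"
  shows "integrable M (\<lambda>\<omega>. X \<omega> powr r)"
proof (rule Bochner_Integration.integrable_bound)
  show "integrable M (\<lambda>\<omega>. 1 + X \<omega>)" using X by simp
  have [measurable]: "X \<in> borel_measurable M" using X by auto
  show "(\<lambda>\<omega>. X \<omega> powr r) \<in> borel_measurable M" by measurable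
  have "X \<omega> powr r \<le> 1 + X \<omega>" for \<omega>
  proof (cases "X \<omega> \<le> 1")
    case True
    then have "X \<omega> powr r \<le> 1" using X(2)[of \<omega>] r by (simp add: powr_le1)
    then show ?thesis using X(2)[of \<omega>] by simp
  next
    case False
    then have "X \<omega> powr r \<le> X \<omega> powr 1" using r by (intro powr_mono) auto
    then show ?thesis using False by simp
  qed
  then show "AE \<omega> in M. norm (X \<omega> powr r) \<le> norm (1 + X \<omega>)"
    using X by (intro AE_I2) auto
qed

text \<open>A reverse of Jensen's inequality. The parabola is applied to \<open>X / s\<close>; the scale
  \<open>s = p / (p - 1) E X\<close> makes \<open>E (X / s) = (p - 1) / p\<close> and bounds \<open>E ((X / s)\<^sup>2)\<close> by the same
  number.\<close>

lemma (in prob_space) expectation_powr_inverse_ge: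
  fixes X :: "'a \<Rightarrow> real" and p :: real
  assumes p: "1 < p" and X: "integrable M X" "integrable M (\<lambda>\<omega>. (X \<omega>)\<^sup>2)" "\<And>\<omega>. 0 \<le> X \<omega>"
    and second: "expectation (\<lambda>\<omega>. (X \<omega>)\<^sup>2) \<le> p / (p - 1) * (expectation X)\<^sup>2"
  shows "(p - 1) / p * expectation X powr (1 / p) \<le> expectation (\<lambda>\<omega>. X \<omega> powr (1 / p))"
proof (cases "expectation X = 0")
  case False
  let ?e = "expectation X" and ?E = "expectation (\<lambda>\<omega>. X \<omega> powr (1 / p))"
  have e: "0 < ?e" using False X(3) by (simp add: order_less_le)
  define s where "s = p / (p - 1) * ?e"
  have s: "0 < s" "?e \<le> s" using p e by (auto simp: s_def field_simps)
  have int: "integrable M (\<lambda>\<omega>. X \<omega> powr (1 / p))"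
    using p by (intro integrable_powr_le_one X) auto
  have "(2 * p - 1) * (X \<omega> / s) \<le> p * (X \<omega> powr (1 / p) / s powr (1 / p)) + (p - 1) * ((X \<omega>)\<^sup>2 / s\<^sup>2)" for \<omega>
    using powr_inverse_ge_parabola[of p "X \<omega> / s"] p s X(3)[of \<omega>]
    by (simp add: powr_divide power_divide)
  then have "expectation (\<lambda>\<omega>. (2 * p - 1) * (X \<omega> / s)) \<le>
      expectation (\<lambda>\<omega>. p * (X \<omega> powr (1 / p) / s powr (1 / p)) + (p - 1) * ((X \<omega>)\<^sup>2 / s\<^sup>2))"
    using X int by (intro integral_mono) auto
  then have "(2 * p - 1) * (?e / s) \<le> p * (?E / s powr (1 / p)) + (p - 1) * (expectation (\<lambda>\<omega>. (X \<omega>)\<^sup>2) / s\<^sup>2)"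
    using X int by simp
  also have "expectation (\<lambda>\<omega>. (X \<omega>)\<^sup>2) / s\<^sup>2 \<le> p / (p - 1) * ?e\<^sup>2 / s\<^sup>2"
    using second s by (intro divide_right_mono) auto
  also have "p / (p - 1) * ?e\<^sup>2 / s\<^sup>2 = (p - 1) / p"
    using p e by (simp add: s_def power2_eq_square field_simps)
  also have "?e / s = (p - 1) / p" using p e by (simp add: s_def)
  finally have "(2 * p - 1) * ((p - 1) / p) - (p - 1) * ((p - 1) / p) \<le> p * (?E / s powr (1 / p))"
    using p by (simp add: mult_left_mono)
  also have "(2 * p - 1) * ((p - 1) / p) - (p - 1) * ((p - 1) / p) = p - 1"
    using p by (simp add: field_simps)
  finally have "(p - 1) / p * s powr (1 / p) \<le> ?E" using p s by (simp add: field_simps)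
  moreover have "(p - 1) / p * ?e powr (1 / p) \<le> (p - 1) / p * s powr (1 / p)"
    using p s e by (intro mult_left_mono powr_mono2) auto
  ultimately show ?thesis by linarith
qed (simp add: integral_nonneg)

section \<open>The mean norm of a Gaussian vector\<close>

lemma \<mu>\<^sub>2_ge:
  assumes p: "2 \<le> p" and m: "(p - 1) * 2 powr (p + 1) \<le> real m"
    and \<xi>: "std_gaussian_vector M m \<xi>"
  shows "(p - 1) / p * (real m powr (1 / p) * (sqrt (p + 1) / 2)) \<le> \<mu>\<^sub>2 M m p \<xi>"
proof -
  interpret prob_space M using \<xi> by (simp add: std_gaussian_vector_def)
  define Y where "Y i \<omega> = \<bar>\<xi> i \<omega>\<bar> powr p" for i \<omega>
  define S where "S \<omega> = (\<Sum>i<m. Y i \<omega>)" for \<omega>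
  define a b where "a = normal_abs_moment p" and "b = normal_abs_moment (2 * p)"
  have Y_sq: "(Y i \<omega>)\<^sup>2 = \<bar>\<xi> i \<omega>\<bar> powr (2 * p)" for i \<omega>
    by (simp add: Y_def power2_eq_square flip: powr_add)
  have dist: "distributed M lborel (\<xi> i) (\<lambda>x. ennreal (std_normal_density x))" if "i < m" for i
    using \<xi> that by (simp add: std_gaussian_vector_def)
  have indep: "indep_vars (\<lambda>_. borel) Y {..<m}"
    unfolding Y_def[abs_def] using \<xi>
    by (intro indep_vars_compose2[where X = \<xi> and Y = "\<lambda>_ x. \<bar>x\<bar> powr p"]) (auto simp: std_gaussian_vector_def)
  have "integrable M S \<and> expectation S = m * a \<and> integrable M (\<lambda>\<omega>. (S \<omega>)\<^sup>2) \<and>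
      expectation (\<lambda>\<omega>. (S \<omega>)\<^sup>2) = m * (b - a\<^sup>2) + (m * a)\<^sup>2"
    unfolding S_def[abs_def]
    using p by (intro indep_sum_moments indep)
      (simp_all add: Y_sq a_def b_def std_gaussian_abs_moment[OF dist], simp_all add: Y_def std_gaussian_abs_moment[OF dist])
  then have S: "integrable M S" "expectation S = m * a" "integrable M (\<lambda>\<omega>. (S \<omega>)\<^sup>2)"
    "expectation (\<lambda>\<omega>. (S \<omega>)\<^sup>2) = m * (b - a\<^sup>2) + (m * a)\<^sup>2" by auto
  have "b \<le> 2 powr (p + 1) * a\<^sup>2"
    using normal_abs_moment_double_le[OF p] by (simp add: a_def b_def)
  also have "\<dots> \<le> m / (p - 1) * a\<^sup>2"
    using m p by (intro mult_right_mono) (simp_all add: field_simps)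
  finally have "m * (b - a\<^sup>2) + (m * a)\<^sup>2 \<le> m * (m / (p - 1) * a\<^sup>2) + (m * a)\<^sup>2"
    by (intro add_right_mono mult_left_mono) (auto intro: order_trans[OF diff_left_mono[of 0]])
  also have "\<dots> = p / (p - 1) * (m * a)\<^sup>2"
    using p by (simp add: field_simps power2_eq_square)
  finally have "(p - 1) / p * expectation S powr (1 / p) \<le> expectation (\<lambda>\<omega>. S \<omega> powr (1 / p))"
    using p S by (intro expectation_powr_inverse_ge) (auto simp: S_def Y_def sum_nonneg)
  also have "expectation (\<lambda>\<omega>. S \<omega> powr (1 / p)) = \<mu>\<^sub>2 M m p \<xi>"
    by (simp add: \<mu>\<^sub>2_def lp_norm_def S_def Y_def)
  finally have "(p - 1) / p * (m * a) powr (1 / p) \<le> \<mu>\<^sub>2 M m p \<xi>"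
    by (simp add: S)
  moreover have "sqrt (p + 1) / 2 \<le> a powr (1 / p)"
  proof -
    have "sqrt (p + 1) / 2 = ((sqrt (p + 1) / 2) powr p) powr (1 / p)"
      using p by (simp add: powr_powr)
    also have "\<dots> \<le> a powr (1 / p)"
      using normal_abs_moment_ge[OF p] p by (intro powr_mono2) (auto simp: a_def)
    finally show ?thesis .
  qed
  then have "(p - 1) / p * (m powr (1 / p) * (sqrt (p + 1) / 2)) \<le> (p - 1) / p * (m powr (1 / p) * a powr (1 / p))"
    using p by (intro mult_left_mono) auto
  ultimately show ?thesis by (simp add: powr_mult)
qed

theorem mainTheorem3:
  fixes p \<alpha> \<kappa> :: real and m :: nat
    and M :: "'a measure" and \<xi> :: "nat \<Rightarrow> 'a \<Rightarrow> real"
  assumes "2 \<le> p" and "0 < \<alpha>" and "0 < \<kappa>" and "0 < m"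
    and "real m \<ge> (p - 1) * 2 powr (p + 1)"
    and "std_gaussian_vector M m \<xi>"
  shows "\<epsilon> m \<kappa> p \<alpha> / \<mu>\<^sub>2 M m p \<xi>
           \<le> p / (p - 1) * (9 * exp 1 / (16 * sqrt 2))
              * (1 / (p + 1) + \<kappa> / sqrt (real m)) powr (1 / p) * (\<alpha> / sqrt (p + 1))
         \<and> (real m > ((p + 1) / p * \<kappa>)\<^sup>2 \<longrightarrow>
              \<epsilon> m \<kappa> p \<alpha> / \<mu>\<^sub>2 M m p \<xi> < 9 * exp 1 / (8 * sqrt 2) * (\<alpha> / sqrt (p + 1)))
         \<and> 9 * exp 1 / (8 * sqrt 2) < (2.17 :: real)"
proof -
  define C where "C = 9 * exp 1 / (16 * sqrt (2::real))"
  define B where "B = 1 / (p + 1) + \<kappa> / sqrt (real m)"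
  define D where "D = \<alpha> / sqrt (p + 1)"
  note p = assms(1) and \<alpha> = assms(2) and \<kappa> = assms(3) and m = assms(4)
  have B: "0 < B" using p \<kappa> m by (simp add: B_def add_pos_pos)
  have D: "0 < D" using p \<alpha> by (simp add: D_def)
  have e: "27/10 \<le> exp (1::real)" "exp (1::real) < 272/100"
    using abs_le_D2[OF e_approx_32] e_less_272 by simp_all
  have sqrt2: "1414/1000 < sqrt (2::real)" "sqrt (2::real) < 1415/1000"
    by (rule real_less_rsqrt, simp add: power2_eq_square)
       (rule real_less_lsqrt, simp_all add: power2_eq_square)
  \<comment> \<open>Numerically, \<open>C \<approx> 1.08\<close> and \<open>2 * C \<approx> 2.162\<close>.\<close>
  have C_ge: "1 \<le> C"
  proof -
    have "16 * sqrt 2 \<le> 9 * exp (1::real)" using e sqrt2 by linarith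
    then show ?thesis by (simp add: C_def)
  qed
  have C_lt: "2 * C < 2.17"
  proof -
    have "9 * exp 1 < 2.17 * (8 * sqrt (2::real))" using e sqrt2 by simp
    then show ?thesis by (simp add: C_def field_simps)
  qed
  have "real m + \<kappa> * (p + 1) * sqrt m = (p + 1) * (m * B)"
  proof -
    have "real m * (\<kappa> / sqrt m) = \<kappa> * sqrt m"
      using m real_sqrt_mult_self[of m] by (simp add: field_simps)
    moreover have "(p + 1) * (m * B) = (p + 1) * (1 / (p + 1)) * m + (p + 1) * (m * (\<kappa> / sqrt m))"
      by (simp only: B_def algebra_simps)
    moreover have "(p + 1) * (1 / (p + 1)) = 1" using p by simp
    ultimately show ?thesis by simp
  qed
  then have \<epsilon>: "\<epsilon> m \<kappa> p \<alpha> = \<alpha> / 2 * (m powr (1 / p) * B powr (1 / p))"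
    using p by (simp add: \<epsilon>_def powr_mult)
  define L where "L = (p - 1) / p * (m powr (1 / p) * (sqrt (p + 1) / 2))"
  have "0 < L" using p m by (simp add: L_def)
  moreover have "L \<le> \<mu>\<^sub>2 M m p \<xi>"
    unfolding L_def using \<mu>\<^sub>2_ge assms by blast
  ultimately have "\<epsilon> m \<kappa> p \<alpha> / \<mu>\<^sub>2 M m p \<xi> \<le> \<alpha> / 2 * (m powr (1 / p) * B powr (1 / p)) / L"
    unfolding \<epsilon> using \<alpha> by (intro divide_left_mono) auto
  also have "\<dots> = p / (p - 1) * B powr (1 / p) * D"
    using p m by (simp add: L_def D_def)
  also have "\<dots> \<le> p / (p - 1) * (C * B powr (1 / p)) * D"
    using p D mult_right_mono[OF C_ge, of "B powr (1 / p)"] by (intro mult_right_mono mult_left_mono) auto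
  finally have main: "\<epsilon> m \<kappa> p \<alpha> / \<mu>\<^sub>2 M m p \<xi> \<le> p / (p - 1) * C * B powr (1 / p) * D"
    by (simp add: mult.assoc)
  have "\<epsilon> m \<kappa> p \<alpha> / \<mu>\<^sub>2 M m p \<xi> < 2 * C * D" if "((p + 1) / p * \<kappa>)\<^sup>2 < real m"
  proof -
    have "(p + 1) / p * \<kappa> < sqrt m" using that by (rule real_less_rsqrt)
    then have "\<kappa> / sqrt m < p / (p + 1)" using p m by (simp add: field_simps)
    also have "p / (p + 1) = 1 - 1 / (p + 1)" using p by (simp add: field_simps)
    finally have "B < 1" by (simp add: B_def)
    then have "B powr (1 / p) < 1" using powr_less_mono2[of "1 / p" B 1] B p by simp
    then have "p / (p - 1) * C * B powr (1 / p) * D < p / (p - 1) * C * 1 * D"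
      using p C_ge D by (intro mult_strict_right_mono mult_strict_left_mono) auto
    also have "\<dots> \<le> 2 * C * 1 * D"
      using p C_ge D by (intro mult_right_mono) (auto simp: field_simps)
    finally show ?thesis using main by simp
  qed
  then show ?thesis using main C_lt by (simp add: C_def B_def D_def)
qed

end
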